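(* Let $\Pi X.\, s\ [\exists\vec{x}.\,\varphi]$ be an existentially constrained term. Then $\Pi X.\, s\ [\exists\vec{x}.\,\varphi] \sim \mathrm{PG}(\Pi X.\, s\ [\exists\vec{x}.\,\varphi])$.
   Context: Fix a many-sorted signature whose sorts are partitioned into theory sorts and term sorts and whose function symbols are partitioned into theory symbols (all argument and result sorts are theory sorts) and term symbols; terms are built from these symbols and sorted variables. A fixed model $\mathcal{M}$ interprets theory sorts and theory symbols; the sort Bool is interpreted as $\{\mathsf{true},\mathsf{false}\}$, the usual connectives and equality are available as theory symbols, and every element of the interpretation of every theory sort is a constant symbol of the signature, called a value; $\mathcal{V}al$ is the set of values. A logical constraint is a Bool-sorted term built from theory symbols and variables. A valuation $\rho$ maps theory-sorted variables to elements of the interpretations of their sorts; $\vDash_{\mathcal{M},\rho}\varphi$ means $\varphi$ evaluates to true under $\rho$. Substitutions are sort-preserving; $\sigma|_U$ agrees with $\sigma$ on $U$ and is the identity elsewhere; $\sigma$ is $X$-valued if $\sigma(X)\subseteq\mathcal{V}al$. $\mathcal{V}ar(\cdot)$ denotes the set of variables occurring in an expression. For a term $s$: $s|_p$ is the subterm at position $p$, $s(p)$ the symbol at $p$, $\mathcal{P}os_U(s)$ the set of positions $p$ with $s(p)\in U$, and $s[t_1,\dots,t_n]_{p_1,\dots,p_n}$ the result of replacing the subterms at parallel positions $p_i$ by $t_i$. An existential constraint $\exists\vec{x}.\,\varphi$ is a pair of a sequence of variables $\vec{x}$ and a logical constraint $\varphi$ with $\{\vec{x}\}\subseteq\mathcal{V}ar(\varphi)$;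 its free variables are $\mathcal{FV}ar(\exists\vec{x}.\varphi)=\mathcal{V}ar(\varphi)\setminus\{\vec{x}\}$. $\vDash_{\mathcal{M},\rho}\exists\vec{x}.\varphi$ iff there are values $\vec{v}$ with $\vDash_{\mathcal{M},\rho}\varphi\{\vec{x}\mapsto\vec{v}\}$. For a substitution $\sigma$, $(\exists\vec{x}.\varphi)\sigma := \exists\vec{x}.(\varphi\,\sigma|_{\mathcal{FV}ar(\exists\vec{x}.\varphi)})$, and $\sigma\vDash_{\mathcal{M}}\exists\vec{x}.\varphi$ means $\sigma(\mathcal{FV}ar(\exists\vec{x}.\varphi))\subseteq\mathcal{V}al$ and $\vDash_{\mathcal{M},\rho}(\exists\vec{x}.\varphi)\sigma$ for all $\rho$. An existentially constrained term $\Pi X.\, s\ [\exists\vec{x}.\,\varphi]$ is a triple of a set $X$ of variables, a term $s$ and an existential constraint with $\mathcal{FV}ar(\exists\vec{x}.\varphi)\subseteq X\subseteq\mathcal{V}ar(s)$ and $\{\vec{x}\}\cap\mathcal{V}ar(s)=\emptyset$. $\Pi X.\, s\ [\exists\vec{x}.\varphi]$ is subsumed by $\Pi Y.\, t\ [\exists\vec{y}.\psi]$ if for every $X$-valued substitution $\sigma$ with $\sigma\vDash_{\mathcal{M}}\exists\vec{x}.\varphi$ there is a $Y$-valued substitution $\gamma$ with $\gamma\vDash_{\mathcal{M}}\exists\vec{y}.\psi$ and $s\sigma=t\gamma$; the two are equivalent ($\sim$) if each is subsumed by the other. PG-transformation: $\mathrm{PG}(\Pi X.\, s\ [\exists\vec{x}.\varphi])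 = \Pi Y.\, t\ [\exists\vec{y}.\psi]$ where $\{p_1,\dots,p_n\}=\mathcal{P}os_{X\cup\mathcal{V}al}(s)$, $w_1,\dots,w_n$ are pairwise distinct fresh variables (of the sorts of $s|_{p_i}$), $Y=\{w_1,\dots,w_n\}$, $t=s[w_1,\dots,w_n]_{p_1,\dots,p_n}$, $\{\vec{y}\}=\{\vec{x}\}\cup X$, and $\psi=\varphi\wedge\bigwedge_{i=1}^n(s|_{p_i}=w_i)$. *)

theory Defs
  imports Main
begin

section \<open>Many-sorted terms\<close>

datatype (funs_term: 'f, vars_term: 'v) trm =
  Var 'v
| Fun 'f "('f, 'v) trm list"

type_synonym pos = "nat list"

primrec subst :: "('v \<Rightarrow> ('f, 'v) trm) \<Rightarrow> ('f, 'v) trm \<Rightarrow> ('f, 'v) trm" where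
  "subst \<sigma> (Var x) = \<sigma> x"
| "subst \<sigma> (Fun f ts) = Fun f (map (subst \<sigma>) ts)"

definition restrict_subst ::
  "('v \<Rightarrow> ('f, 'v) trm) \<Rightarrow> 'v set \<Rightarrow> 'v \<Rightarrow> ('f, 'v) trm" where
  "restrict_subst \<sigma> U = (\<lambda>x. if x \<in> U then \<sigma> x else Var x)"

function poss :: "('f, 'v) trm \<Rightarrow> pos set" where
  "poss (Var x) = {[]}"
| "poss (Fun f ts) = insert [] (\<Union>i \<in> {..<length ts}. (#) i ` poss (ts ! i))"
  by pat_completeness auto
termination
  by (relation "measure size") (auto simp: less_Suc_eq_le intro!: size_list_estimation'[OF nth_mem])

fun subt_at :: "('f, 'v) trm \<Rightarrow> pos \<Rightarrow> ('f, 'v) trm" where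
  "subt_at s [] = s"
| "subt_at (Fun f ts) (i # p) = subt_at (ts ! i) p"
| "subt_at (Var x) (i # p) = undefined"

fun replace_at :: "('f, 'v) trm \<Rightarrow> pos \<Rightarrow> ('f, 'v) trm \<Rightarrow> ('f, 'v) trm" where
  "replace_at s [] u = u"
| "replace_at (Fun f ts) (i # p) u = Fun f (ts[i := replace_at (ts ! i) p u])"
| "replace_at (Var x) (i # p) u = undefined"

text \<open>For pairwise parallel positions the order of the replacements is immaterial.\<close>

fun replace_parallel ::
  "('f, 'v) trm \<Rightarrow> pos list \<Rightarrow> ('f, 'v) trm list \<Rightarrow> ('f, 'v) trm" where
  "replace_parallel s (p # ps) (u # us) = replace_parallel (replace_at s p u) ps us"
| "replace_parallel s _ _ = s"

text \<open>A symbol is a variable (left summand) or a function symbol (right summand), so that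
  the set of symbols \<open>X \<union> Val\<close> is written \<open>X <+> Val\<close>.\<close>

fun root_sym :: "('f, 'v) trm \<Rightarrow> 'v + 'f" where
  "root_sym (Var x) = Inl x"
| "root_sym (Fun f ts) = Inr f"

definition poss_of :: "('v + 'f) set \<Rightarrow> ('f, 'v) trm \<Rightarrow> pos set" where
  "poss_of U s = {p \<in> poss s. root_sym (subt_at s p) \<in> U}"


section \<open>Signature and model\<close>

text \<open>Sorts outside \<open>theory_sorts\<close> are the term sorts and symbols outside \<open>theory_syms\<close> are the
  term symbols. Since every element of the interpretation of a theory sort is itself a constant
  symbol, the carriers \<open>interp_sort\<close> are sets of function symbols.\<close>

record ('s, 'f, 'v) sig_model =
  theory_sorts :: "'s set"
  theory_syms :: "'f set"
  fun_sort :: "'f \<Rightarrow> 's list \<times> 's"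
  var_sort :: "'v \<Rightarrow> 's"
  interp_sort :: "'s \<Rightarrow> 'f set"
  interp_fun :: "'f \<Rightarrow> 'f list \<Rightarrow> 'f"
  bool_sort :: 's
  true_val :: 'f
  false_val :: 'f
  not_sym :: 'f
  and_sym :: 'f
  or_sym :: 'f
  imp_sym :: 'f
  iff_sym :: 'f
  eq_sym :: "'s \<Rightarrow> 'f"

definition bool_val :: "('s, 'f, 'v) sig_model \<Rightarrow> bool \<Rightarrow> 'f" where
  "bool_val M b = (if b then true_val M else false_val M)"

locale constrained_setting =
  fixes M :: "('s, 'f, 'v) sig_model"
  assumes infinite_vars: "\<And>\<tau>. infinite {x. var_sort M x = \<tau>}"
    and theory_sym_sorts:
      "\<And>f \<tau>s \<tau>. f \<in> theory_syms M \<Longrightarrow> fun_sort M f = (\<tau>s, \<tau>) \<Longrightarrow>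
        set \<tau>s \<subseteq> theory_sorts M \<and> \<tau> \<in> theory_sorts M"
    and interp_sort_nonempty: "\<And>\<tau>. \<tau> \<in> theory_sorts M \<Longrightarrow> interp_sort M \<tau> \<noteq> {}"
    and interp_fun_closed:
      "\<And>f \<tau>s \<tau> as. f \<in> theory_syms M \<Longrightarrow> fun_sort M f = (\<tau>s, \<tau>) \<Longrightarrow>
        list_all2 (\<lambda>a \<upsilon>. a \<in> interp_sort M \<upsilon>) as \<tau>s \<Longrightarrow> interp_fun M f as \<in> interp_sort M \<tau>"
    and values_are_constants:
      "\<And>\<tau> v. \<tau> \<in> theory_sorts M \<Longrightarrow> v \<in> interp_sort M \<tau> \<Longrightarrow>
        v \<in> theory_syms M \<and> fun_sort M v = ([], \<tau>) \<and> interp_fun M v [] = v"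
    and bool_sort: "bool_sort M \<in> theory_sorts M"
    and interp_bool: "interp_sort M (bool_sort M) = {true_val M, false_val M}"
    and true_neq_false: "true_val M \<noteq> false_val M"
    and not_sym: "not_sym M \<in> theory_syms M"
      "fun_sort M (not_sym M) = ([bool_sort M], bool_sort M)"
      "\<And>a. interp_fun M (not_sym M) [bool_val M a] = bool_val M (\<not> a)"
    and and_sym: "and_sym M \<in> theory_syms M"
      "fun_sort M (and_sym M) = ([bool_sort M, bool_sort M], bool_sort M)"
      "\<And>a b. interp_fun M (and_sym M) [bool_val M a, bool_val M b] = bool_val M (a \<and> b)"
    and or_sym: "or_sym M \<in> theory_syms M"
      "fun_sort M (or_sym M) = ([bool_sort M, bool_sort M], bool_sort M)"
      "\<And>a b. interp_fun M (or_sym M) [bool_val M a, bool_val M b] = bool_val M (a \<or> b)"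
    and imp_sym: "imp_sym M \<in> theory_syms M"
      "fun_sort M (imp_sym M) = ([bool_sort M, bool_sort M], bool_sort M)"
      "\<And>a b. interp_fun M (imp_sym M) [bool_val M a, bool_val M b] = bool_val M (a \<longrightarrow> b)"
    and iff_sym: "iff_sym M \<in> theory_syms M"
      "fun_sort M (iff_sym M) = ([bool_sort M, bool_sort M], bool_sort M)"
      "\<And>a b. interp_fun M (iff_sym M) [bool_val M a, bool_val M b] = bool_val M (a \<longleftrightarrow> b)"
    and eq_sym:
      "\<And>\<tau>. \<tau> \<in> theory_sorts M \<Longrightarrow> eq_sym M \<tau> \<in> theory_syms M"
      "\<And>\<tau>. \<tau> \<in> theory_sorts M \<Longrightarrow> fun_sort M (eq_sym M \<tau>) = ([\<tau>, \<tau>], bool_sort M)"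
      "\<And>\<tau> a b. \<tau> \<in> theory_sorts M \<Longrightarrow> a \<in> interp_sort M \<tau> \<Longrightarrow> b \<in> interp_sort M \<tau> \<Longrightarrow>
        interp_fun M (eq_sym M \<tau>) [a, b] = bool_val M (a = b)"

inductive has_sort :: "('s, 'f, 'v) sig_model \<Rightarrow> ('f, 'v) trm \<Rightarrow> 's \<Rightarrow> bool"
  for M :: "('s, 'f, 'v) sig_model" where
  Var: "has_sort M (Var x) (var_sort M x)"
| Fun: "fun_sort M f = (\<tau>s, \<tau>) \<Longrightarrow> list_all2 (has_sort M) ts \<tau>s \<Longrightarrow> has_sort M (Fun f ts) \<tau>"

definition Val :: "('s, 'f, 'v) sig_model \<Rightarrow> 'f set" where
  "Val M = (\<Union>\<tau> \<in> theory_sorts M. interp_sort M \<tau>)"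

abbreviation Const :: "'f \<Rightarrow> ('f, 'v) trm" where
  "Const c \<equiv> Fun c []"

definition is_subst :: "('s, 'f, 'v) sig_model \<Rightarrow> ('v \<Rightarrow> ('f, 'v) trm) \<Rightarrow> bool" where
  "is_subst M \<sigma> \<longleftrightarrow> (\<forall>x. has_sort M (\<sigma> x) (var_sort M x))"

definition valued ::
  "('s, 'f, 'v) sig_model \<Rightarrow> 'v set \<Rightarrow> ('v \<Rightarrow> ('f, 'v) trm) \<Rightarrow> bool" where
  "valued M X \<sigma> \<longleftrightarrow> \<sigma> ` X \<subseteq> Const ` Val M"

definition is_valuation :: "('s, 'f, 'v) sig_model \<Rightarrow> ('v \<Rightarrow> 'f) \<Rightarrow> bool" where
  "is_valuation M \<rho> \<longleftrightarrow>
    (\<forall>x. var_sort M x \<in> theory_sorts M \<longrightarrow> \<rho> x \<in> interp_sort M (var_sort M x))"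

primrec eval :: "('s, 'f, 'v) sig_model \<Rightarrow> ('v \<Rightarrow> 'f) \<Rightarrow> ('f, 'v) trm \<Rightarrow> 'f" where
  "eval M \<rho> (Var x) = \<rho> x"
| "eval M \<rho> (Fun f ts) = interp_fun M f (map (eval M \<rho>) ts)"

definition holds :: "('s, 'f, 'v) sig_model \<Rightarrow> ('v \<Rightarrow> 'f) \<Rightarrow> ('f, 'v) trm \<Rightarrow> bool" where
  "holds M \<rho> \<phi> \<longleftrightarrow> eval M \<rho> \<phi> = true_val M"

definition logical_constraint :: "('s, 'f, 'v) sig_model \<Rightarrow> ('f, 'v) trm \<Rightarrow> bool" where
  "logical_constraint M \<phi> \<longleftrightarrow> has_sort M \<phi> (bool_sort M) \<and> funs_term \<phi> \<subseteq> theory_syms M"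


section \<open>Existential constraints\<close>

type_synonym ('f, 'v) ex_constraint = "'v list \<times> ('f, 'v) trm"

definition ex_constraint :: "('s, 'f, 'v) sig_model \<Rightarrow> ('f, 'v) ex_constraint \<Rightarrow> bool" where
  "ex_constraint M = (\<lambda>(xs, \<phi>). logical_constraint M \<phi> \<and> set xs \<subseteq> vars_term \<phi>)"

definition FVar :: "('f, 'v) ex_constraint \<Rightarrow> 'v set" where
  "FVar = (\<lambda>(xs, \<phi>). vars_term \<phi> - set xs)"

definition value_subst :: "'v list \<Rightarrow> 'f list \<Rightarrow> 'v \<Rightarrow> ('f, 'v) trm" where
  "value_subst xs vs x =
    (case map_of (zip xs vs) x of None \<Rightarrow> Var x | Some v \<Rightarrow> Const v)"

definition ex_holds ::
  "('s, 'f, 'v) sig_model \<Rightarrow> ('v \<Rightarrow> 'f) \<Rightarrow> ('f, 'v) ex_constraint \<Rightarrow> bool" where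
  "ex_holds M \<rho> = (\<lambda>(xs, \<phi>). \<exists>vs.
    list_all2 (\<lambda>x v. v \<in> interp_sort M (var_sort M x)) xs vs \<and>
    holds M \<rho> (subst (value_subst xs vs) \<phi>))"

definition ex_subst ::
  "('v \<Rightarrow> ('f, 'v) trm) \<Rightarrow> ('f, 'v) ex_constraint \<Rightarrow> ('f, 'v) ex_constraint" where
  "ex_subst \<sigma> = (\<lambda>(xs, \<phi>). (xs, subst (restrict_subst \<sigma> (FVar (xs, \<phi>))) \<phi>))"

definition subst_models ::
  "('s, 'f, 'v) sig_model \<Rightarrow> ('v \<Rightarrow> ('f, 'v) trm) \<Rightarrow> ('f, 'v) ex_constraint \<Rightarrow> bool" where
  "subst_models M \<sigma> E \<longleftrightarrow>
    \<sigma> ` FVar E \<subseteq> Const ` Val M \<and> (\<forall>\<rho>. is_valuation M \<rho> \<longrightarrow> ex_holds M \<rho> (ex_subst \<sigma> E))"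


section \<open>Existentially constrained terms\<close>

type_synonym ('f, 'v) ec_term = "'v set \<times> ('f, 'v) trm \<times> ('f, 'v) ex_constraint"

definition ec_term :: "('s, 'f, 'v) sig_model \<Rightarrow> ('f, 'v) ec_term \<Rightarrow> bool" where
  "ec_term M = (\<lambda>(X, s, (xs, \<phi>)).
    (\<exists>\<tau>. has_sort M s \<tau>) \<and> ex_constraint M (xs, \<phi>) \<and>
    FVar (xs, \<phi>) \<subseteq> X \<and> X \<subseteq> vars_term s \<and> set xs \<inter> vars_term s = {})"

definition subsumed ::
  "('s, 'f, 'v) sig_model \<Rightarrow> ('f, 'v) ec_term \<Rightarrow> ('f, 'v) ec_term \<Rightarrow> bool" where
  "subsumed M = (\<lambda>(X, s, E) (Y, t, F).
    \<forall>\<sigma>. is_subst M \<sigma> \<and> valued M X \<sigma> \<and> subst_models M \<sigma> E \<longrightarrow>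
      (\<exists>\<gamma>. is_subst M \<gamma> \<and> valued M Y \<gamma> \<and> subst_models M \<gamma> F \<and> subst \<sigma> s = subst \<gamma> t))"

definition ec_equiv ::
  "('s, 'f, 'v) sig_model \<Rightarrow> ('f, 'v) ec_term \<Rightarrow> ('f, 'v) ec_term \<Rightarrow> bool" where
  "ec_equiv M C D \<longleftrightarrow> subsumed M C D \<and> subsumed M D C"


section \<open>PG-transformation\<close>

definition And ::
  "('s, 'f, 'v) sig_model \<Rightarrow> ('f, 'v) trm \<Rightarrow> ('f, 'v) trm \<Rightarrow> ('f, 'v) trm" where
  "And M \<phi> \<psi> = Fun (and_sym M) [\<phi>, \<psi>]"

definition Big_And :: "('s, 'f, 'v) sig_model \<Rightarrow> ('f, 'v) trm list \<Rightarrow> ('f, 'v) trm" where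
  "Big_And M \<phi>s = foldr (And M) \<phi>s (Const (true_val M))"

definition Eq_Var ::
  "('s, 'f, 'v) sig_model \<Rightarrow> ('f, 'v) trm \<Rightarrow> 'v \<Rightarrow> ('f, 'v) trm" where
  "Eq_Var M u w = Fun (eq_sym M (var_sort M w)) [u, Var w]"

text \<open>The transformation is determined only up to the enumeration of the positions, the choice
  of the fresh variables and the order of the bound variables; \<open>PG M C D\<close> says that \<open>D\<close> is a
  result of the transformation of \<open>C\<close> for some such choice.\<close>

definition PG ::
  "('s, 'f, 'v) sig_model \<Rightarrow> ('f, 'v) ec_term \<Rightarrow> ('f, 'v) ec_term \<Rightarrow> bool" where
  "PG M = (\<lambda>(X, s, (xs, \<phi>)) (Y, t, (ys, \<psi>)).
    \<exists>ps ws.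
      distinct ps \<and> set ps = poss_of (X <+> Val M) s \<and>
      distinct ws \<and> set ws \<inter> (X \<union> vars_term s \<union> set xs \<union> vars_term \<phi>) = {} \<and>
      list_all2 (\<lambda>p w. has_sort M (subt_at s p) (var_sort M w)) ps ws \<and>
      Y = set ws \<and>
      t = replace_parallel s ps (map Var ws) \<and>
      set ys = set xs \<union> X \<and>
      \<psi> = And M \<phi> (Big_And M (map2 (\<lambda>p w. Eq_Var M (subt_at s p) w) ps ws)))"

lemma finite_poss: "finite (poss s)"
  by (induction s) auto

lemma subt_at_has_sort: "has_sort M s \<tau> \<Longrightarrow> p \<in> poss s \<Longrightarrow> \<exists>\<upsilon>. has_sort M (subt_at s p) \<upsilon>"
proof (induction s p arbitrary: \<tau> rule: subt_at.induct)
  case (2 f ts i p)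
  from 2(2) obtain \<tau>s where "list_all2 (has_sort M) ts \<tau>s" by (auto elim: has_sort.cases)
  with 2 show ?case by (auto simp: list_all2_conv_all_nth)
qed auto

context constrained_setting
begin

lemma fresh_vars:
  assumes "finite A" and "\<forall>p \<in> set ps. \<exists>\<upsilon>. has_sort M (subt_at s p) \<upsilon>"
  shows "\<exists>ws. distinct ws \<and> set ws \<inter> A = {} \<and>
    list_all2 (\<lambda>p w. has_sort M (subt_at s p) (var_sort M w)) ps ws"
  using assms(2)
proof (induction ps)
  case (Cons p ps)
  then obtain ws where ws: "distinct ws" "set ws \<inter> A = {}"
    "list_all2 (\<lambda>p w. has_sort M (subt_at s p) (var_sort M w)) ps ws" by auto
  from Cons.prems obtain \<upsilon> where \<upsilon>: "has_sort M (subt_at s p) \<upsilon>" by auto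
  have "infinite ({x. var_sort M x = \<upsilon>} - (A \<union> set ws))"
    using infinite_vars[of \<upsilon>] assms(1) by (simp add: Diff_infinite_finite)
  then obtain w where "w \<in> {x. var_sort M x = \<upsilon>} - (A \<union> set ws)"
    using infinite_imp_nonempty by blast
  with ws \<upsilon> show ?case by (intro exI[of _ "w # ws"]) auto
qed simp

lemma PG_exists:
  assumes "ec_term M C"
  shows "\<exists>D. PG M C D"
proof -
  obtain X s xs \<phi> where C: "C = (X, s, (xs, \<phi>))" by (metis prod.exhaust)
  from assms obtain \<tau> where \<tau>: "has_sort M s \<tau>" and X: "X \<subseteq> vars_term s"
    unfolding C ec_term_def by auto
  have fin: "finite (vars_term u)" for u :: "('f, 'v) trm" by (induction u) auto
  have "finite X" using X fin finite_subset by blast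
  then obtain ys where ys: "set ys = set xs \<union> X" by (metis List.finite_set finite_UnI finite_list)
  have "finite (poss_of (X <+> Val M) s)" by (simp add: poss_of_def finite_poss)
  then obtain ps where ps: "distinct ps" "set ps = poss_of (X <+> Val M) s"
    using finite_distinct_list by metis
  have "\<forall>p \<in> set ps. \<exists>\<upsilon>. has_sort M (subt_at s p) \<upsilon>"
    using ps(2) subt_at_has_sort[OF \<tau>] by (auto simp: poss_of_def)
  with fresh_vars[of "X \<union> vars_term s \<union> set xs \<union> vars_term \<phi>" ps s] \<open>finite X\<close> fin
  obtain ws where "distinct ws" "set ws \<inter> (X \<union> vars_term s \<union> set xs \<union> vars_term \<phi>) = {}"
    "list_all2 (\<lambda>p w. has_sort M (subt_at s p) (var_sort M w)) ps ws" by auto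
  with ps ys have "PG M C (set ws, replace_parallel s ps (map Var ws), (ys,
      And M \<phi> (Big_And M (map2 (\<lambda>p w. Eq_Var M (subt_at s p) w) ps ws))))"
    unfolding C PG_def by auto
  then show ?thesis by blast
qed

end

end

theory Submission
  imports Defs
begin

text \<open>The variables in \<open>X\<close> and the values occur only at leaves of \<open>s\<close>, so replacing them by the
  fresh variables \<open>w\<^sub>i\<close> neither overlaps nor changes the set of positions. An instance of the
  original term becomes an instance of the transformed one by sending \<open>w\<^sub>i\<close> to the instance of
  \<open>s|\<^bsub>p\<^sub>i\<^esub>\<close>, with the old values of \<open>X\<close> as witnesses of the new existential quantifiers. Conversely,
  the witnesses for \<open>X\<close> define the required substitution, and the equations \<open>s|\<^bsub>p\<^sub>i\<^esub> = w\<^sub>i\<close> force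
  both instances to coincide. If some variable of \<open>X\<close> has a term sort, so has some \<open>w\<^sub>i\<close>, and there
  are no instances on either side.\<close>

section \<open>Replacing leaves\<close>

lemma subst_cong: "(\<And>x. x \<in> vars_term s \<Longrightarrow> \<sigma> x = \<tau> x) \<Longrightarrow> subst \<sigma> s = subst \<tau> s"
  by (induction s) auto

text \<open>Turns occurrence of a variable into a statement about positions, the form in which
  \<open>poss_of\<close> and the replacements are handled.\<close>

lemma vars_term_iff_subt_at: "x \<in> vars_term s \<longleftrightarrow> (\<exists>p \<in> poss s. subt_at s p = Var x)"
proof (induction s)
  case (Fun f ts)
  have "x \<in> vars_term (Fun f ts) \<longleftrightarrow> (\<exists>i < length ts. x \<in> vars_term (ts ! i))"
    by simp (metis in_set_conv_nth)
  also have "\<dots> \<longleftrightarrow> (\<exists>i < length ts. \<exists>p \<in> poss (ts ! i). subt_at (ts ! i) p = Var x)"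
    using Fun.IH nth_mem by blast
  also have "\<dots> \<longleftrightarrow> (\<exists>p \<in> poss (Fun f ts). subt_at (Fun f ts) p = Var x)"
    by auto
  finally show ?case .
qed auto

section \<open>Replacing a single leaf\<close>

lemma Cons_in_poss_Fun: "i # p \<in> poss (Fun f ts) \<longleftrightarrow> i < length ts \<and> p \<in> poss (ts ! i)"
  by auto

text \<open>Only instances are compared, so \<open>u\<close> may be a fresh variable, provided
  \<sigma> sends it to the instance of the subterm it replaces.\<close>

lemma subst_replace_at:
  assumes "p \<in> poss s" and "subst \<sigma> u = subst \<sigma> (subt_at s p)"
  shows "subst \<sigma> (replace_at s p u) = subst \<sigma> s"
  using assms
proof (induction s p u rule: replace_at.induct)
  case (2 f ts i p u)
  then have "subst \<sigma> (replace_at (ts ! i) p u) = subst \<sigma> (ts ! i)" by auto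
  then show ?case by (simp add: map_update) (metis list_update_id map_update)
qed auto

text \<open>A leaf is described by \<open>poss u = {[]}\<close>, which covers both variables and constants.\<close>

lemma subt_at_replace_at_other_leaf:
  assumes "p \<in> poss s" and "poss (subt_at s p) = {[]}"
    and "q \<in> poss s" and "poss (subt_at s q) = {[]}" and "q \<noteq> p"
  shows "q \<in> poss (replace_at s p u) \<and> subt_at (replace_at s p u) q = subt_at s q"
  using assms
proof (induction s p u arbitrary: q rule: replace_at.induct)
  case (2 f ts i p u)
  show ?case
  proof (cases q)
    \<comment> \<open>A leaf at the root would leave no room for the position
      \<open>i # p\<close>.\<close>
    case Nil
    with "2.prems"(4) have "poss (Fun f ts) = {[]}" by simp
    with "2.prems"(1) have False by (simp only: singleton_iff list.distinct)
    then show ?thesis ..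
  next
    case (Cons j q')
    with 2 show ?thesis
      by (cases "j = i") (simp_all add: Cons_in_poss_Fun del: poss.simps)
  qed
qed auto

text \<open>Everything at or below \<open>p\<close> gives way to the single position of
  \<open>w\<close>; all other positions keep their subterm if that is a variable.\<close>

lemma subt_at_replace_at_VarD:
  assumes "p \<in> poss s" and "q \<in> poss (replace_at s p (Var w))"
    and "subt_at (replace_at s p (Var w)) q = Var x"
  shows "x = w \<or> (q \<in> poss s \<and> q \<noteq> p \<and> subt_at s q = Var x)"
  using assms
proof (induction s p "Var w :: ('a, 'b) trm" arbitrary: q rule: replace_at.induct)
  case (2 f ts i p)
  show ?case
  proof (cases q)
    case Nil
    with "2.prems"(3) show ?thesis by simp
  next
    case (Cons j q')
    with 2 show ?thesis
      by (cases "j = i") (auto simp: Cons_in_poss_Fun simp del: poss.simps)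
  qed
qed auto

text \<open>Distinct leaves are parallel, so each replacement leaves the remaining positions and
  their subterms intact. The condition on \<sigma> can therefore refer to the original
  \<open>s\<close> throughout.\<close>

lemma subst_replace_parallel:
  assumes "length ps = length ws" and "distinct ps"
    and "\<And>p. p \<in> set ps \<Longrightarrow> p \<in> poss s \<and> poss (subt_at s p) = {[]}"
    and "\<And>p w. (p, w) \<in> set (zip ps ws) \<Longrightarrow> \<sigma> w = subst \<sigma> (subt_at s p)"
  shows "subst \<sigma> (replace_parallel s ps (map Var ws)) = subst \<sigma> s"
  using assms
proof (induction ps ws arbitrary: s rule: list_induct2)
  case (Cons p ps w ws)
  let ?s = "replace_at s p (Var w)"
  have other: "q \<in> poss ?s \<and> subt_at ?s q = subt_at s q" if "q \<in> set ps" for q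
    using that Cons.prems(1) Cons.prems(2)[of p] Cons.prems(2)[of q]
    by (intro subt_at_replace_at_other_leaf) auto
  have "subst \<sigma> (replace_parallel ?s ps (map Var ws)) = subst \<sigma> ?s"
  proof (rule Cons.IH)
    show "distinct ps" using Cons.prems(1) by simp
    show "q \<in> poss ?s \<and> poss (subt_at ?s q) = {[]}" if "q \<in> set ps" for q
      using other[OF that] Cons.prems(2)[of q] that by simp
    show "\<sigma> v = subst \<sigma> (subt_at ?s q)" if "(q, v) \<in> set (zip ps ws)" for q v
      using other[of q] Cons.prems(3)[of q v] that by (simp add: set_zip_leftD)
  qed
  also have "\<dots> = subst \<sigma> s"
    using Cons.prems(2)[of p] Cons.prems(3)[of p w] by (intro subst_replace_at) auto
  finally show ?case by simp
qed simp

lemma subt_at_replace_parallel_VarD: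
  assumes "length ps = length ws" and "distinct ps"
    and "\<And>p. p \<in> set ps \<Longrightarrow> p \<in> poss s \<and> poss (subt_at s p) = {[]}"
    and "q \<in> poss (replace_parallel s ps (map Var ws))"
    and "subt_at (replace_parallel s ps (map Var ws)) q = Var x"
  shows "x \<in> set ws \<or> (q \<in> poss s \<and> q \<notin> set ps \<and> subt_at s q = Var x)"
  using assms
proof (induction ps ws arbitrary: s rule: list_induct2)
  case (Cons p ps w ws)
  let ?s = "replace_at s p (Var w)"
  have "r \<in> poss ?s \<and> subt_at ?s r = subt_at s r" if "r \<in> set ps" for r
    using that Cons.prems(1) Cons.prems(2)[of p] Cons.prems(2)[of r]
    by (intro subt_at_replace_at_other_leaf) auto
  then have "x \<in> set ws \<or> (q \<in> poss ?s \<and> q \<notin> set ps \<and> subt_at ?s q = Var x)"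
    using Cons.prems by (intro Cons.IH) auto
  then show ?case
    using subt_at_replace_at_VarD[of p s q w x] Cons.prems(2)[of p] by auto
qed simp


section \<open>Semantics of constraints\<close>

lemma eval_subst: "eval M \<rho> (subst \<sigma> t) = eval M (\<lambda>x. eval M \<rho> (\<sigma> x)) t"
  by (induction t) (auto simp: comp_def cong: map_cong)

lemma eval_cong: "(\<And>x. x \<in> vars_term t \<Longrightarrow> \<rho> x = \<rho>' x) \<Longrightarrow> eval M \<rho> t = eval M \<rho>' t"
proof (induction t)
  case (Fun f ts)
  then have "map (eval M \<rho>) ts = map (eval M \<rho>') ts" by auto
  then show ?case by (simp only: eval.simps)
qed simp

section \<open>Values, sorts and evaluation in the model\<close>

context constrained_setting
begin

text \<open>The signature declares one sort per value, so the carrier containing \<open>v\<close> is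
  that of \<tau>. Hence a variable that a sort-preserving substitution sends to a value has a theory
  sort.\<close>

lemma value_sortD:
  assumes "v \<in> Val M" and "has_sort M (Const v) \<tau>"
  shows "\<tau> \<in> theory_sorts M" "v \<in> interp_sort M \<tau>"
proof -
  obtain \<upsilon> where "\<upsilon> \<in> theory_sorts M" "v \<in> interp_sort M \<upsilon>"
    using assms(1) by (auto simp: Val_def)
  moreover from this have "\<upsilon> = \<tau>"
    using values_are_constants[of \<upsilon> v] assms(2) by (auto elim: has_sort.cases)
  ultimately show "\<tau> \<in> theory_sorts M" "v \<in> interp_sort M \<tau>" by auto
qed

lemma has_sort_Const_value:
  "\<tau> \<in> theory_sorts M \<Longrightarrow> v \<in> interp_sort M \<tau> \<Longrightarrow> has_sort M (Const v) \<tau>"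
  using values_are_constants by (auto intro: has_sort.Fun)

lemma interp_fun_value: "v \<in> Val M \<Longrightarrow> interp_fun M v [] = v"
  using values_are_constants by (auto simp: Val_def)

text \<open>The term datatype does not enforce arities; well-sortedness makes value symbols nullary,
  so their positions are leaves.\<close>

lemma value_no_args: "v \<in> Val M \<Longrightarrow> has_sort M (Fun v ts) \<tau> \<Longrightarrow> ts = []"
  using values_are_constants by (fastforce simp: Val_def elim: has_sort.cases)

text \<open>Keeps the quantification over all valuations in \<open>subst_models\<close> from being
  vacuous.\<close>

lemma valuation_exists: "\<exists>\<rho>. is_valuation M \<rho>"
  unfolding is_valuation_def using interp_sort_nonempty
  by (intro exI[of _ "\<lambda>x. SOME v. v \<in> interp_sort M (var_sort M x)"]) (simp add: some_in_eq)

text \<open>Only the variables of \<open>t\<close> are restricted, so the lemma also applies to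
  assignments that are not valuations.\<close>

lemma eval_in_interp_sort:
  assumes "has_sort M t \<tau>" and "funs_term t \<subseteq> theory_syms M"
    and "\<And>x. x \<in> vars_term t \<Longrightarrow> \<rho> x \<in> interp_sort M (var_sort M x)"
  shows "eval M \<rho> t \<in> interp_sort M \<tau>"
  using assms
proof (induction t arbitrary: \<tau>)
  case (Var x)
  then show ?case by (auto elim: has_sort.cases)
next
  case (Fun f ts)
  obtain \<tau>s where \<tau>s: "fun_sort M f = (\<tau>s, \<tau>)" "list_all2 (has_sort M) ts \<tau>s"
    using Fun.prems(1) by (auto elim: has_sort.cases)
  have "eval M \<rho> t \<in> interp_sort M \<upsilon>" if "t \<in> set ts" "has_sort M t \<upsilon>" for t \<upsilon>
    using that Fun.prems by (intro Fun.IH) auto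
  then have "list_all2 (\<lambda>a \<upsilon>. a \<in> interp_sort M \<upsilon>) (map (eval M \<rho>) ts) \<tau>s"
    using \<tau>s(2) by (auto simp: list_all2_conv_all_nth)
  then show ?case using \<tau>s(1) Fun.prems(2) interp_fun_closed by auto
qed

text \<open>The connectives are specified on Boolean values only, so a constraint must be known to
  evaluate to one before \<open>and_sym\<close> can be computed.\<close>

lemma logical_constraint_bool_val:
  assumes "logical_constraint M \<phi>"
    and "\<And>x. x \<in> vars_term \<phi> \<Longrightarrow> \<rho> x \<in> interp_sort M (var_sort M x)"
  shows "eval M \<rho> \<phi> = bool_val M (holds M \<rho> \<phi>)"
  using eval_in_interp_sort[of \<phi> "bool_sort M" \<rho>] assms interp_bool
  by (auto simp: logical_constraint_def holds_def bool_val_def)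

section \<open>Truth of the constraint built by the transformation\<close>

lemma eval_Big_And:
  assumes "\<And>\<phi>. \<phi> \<in> set \<phi>s \<Longrightarrow> eval M \<rho> \<phi> = bool_val M (P \<phi>)"
  shows "eval M \<rho> (Big_And M \<phi>s) = bool_val M (\<forall>\<phi> \<in> set \<phi>s. P \<phi>)"
  using assms
proof (induction \<phi>s)
  case Nil
  have "true_val M \<in> Val M" using bool_sort interp_bool by (auto simp: Val_def)
  then show ?case by (simp add: Big_And_def bool_val_def interp_fun_value)
next
  case (Cons \<phi> \<phi>s)
  then show ?case by (simp add: Big_And_def And_def and_sym(3))
qed

text \<open>\<open>eq_sym\<close> is specified only inside the carrier of a theory sort; the second
  assumption places both sides of every equation there.\<close>

lemma holds_And_Big_And_Eq_Var:
  assumes "eval M \<rho> \<phi> = bool_val M (holds M \<rho> \<phi>)"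
    and "\<And>p w. (p, w) \<in> set (zip ps ws) \<Longrightarrow> var_sort M w \<in> theory_sorts M \<and>
      eval M \<rho> (f p) \<in> interp_sort M (var_sort M w) \<and> \<rho> w \<in> interp_sort M (var_sort M w)"
  shows "holds M \<rho> (And M \<phi> (Big_And M (map2 (\<lambda>p w. Eq_Var M (f p) w) ps ws))) \<longleftrightarrow>
    holds M \<rho> \<phi> \<and> (\<forall>(p, w) \<in> set (zip ps ws). eval M \<rho> (f p) = \<rho> w)"
proof -
  have bool_val_iff: "bool_val M b = true_val M \<longleftrightarrow> b" for b
    using true_neq_false by (auto simp: bool_val_def)
  have eq: "eval M \<rho> (Eq_Var M (f p) w) = bool_val M (eval M \<rho> (f p) = \<rho> w)"
    if "(p, w) \<in> set (zip ps ws)" for p w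
    using assms(2)[OF that] by (simp add: Eq_Var_def eq_sym(3))
  have "eval M \<rho> (Big_And M (map2 (\<lambda>p w. Eq_Var M (f p) w) ps ws)) =
    bool_val M (\<forall>\<theta> \<in> set (map2 (\<lambda>p w. Eq_Var M (f p) w) ps ws). eval M \<rho> \<theta> = true_val M)"
    using eq by (intro eval_Big_And) (auto simp: bool_val_iff)
  also have "\<dots> = bool_val M (\<forall>(p, w) \<in> set (zip ps ws). eval M \<rho> (f p) = \<rho> w)"
    using eq bool_val_iff by (intro arg_cong[of _ _ "bool_val M"]) fastforce
  finally have "eval M \<rho> (And M \<phi> (Big_And M (map2 (\<lambda>p w. Eq_Var M (f p) w) ps ws))) =
    bool_val M (holds M \<rho> \<phi> \<and> (\<forall>(p, w) \<in> set (zip ps ws). eval M \<rho> (f p) = \<rho> w))"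
    using assms(1) by (simp add: And_def and_sym(3))
  then show ?thesis by (simp only: holds_def[of _ _ "And _ _ _"] bool_val_iff)
qed

text \<open>Outside the variables of \<open>\<phi>\<close> the assignment \<open>\<rho>\<close> is unconstrained; in particular it need not
  be a valuation.\<close>

lemma subst_models_iff:
  assumes theory_sorts: "\<And>x. x \<in> set xs \<Longrightarrow> var_sort M x \<in> theory_sorts M"
  shows "subst_models M \<sigma> (xs, \<phi>) \<longleftrightarrow>
    (\<exists>\<rho>. (\<forall>x \<in> FVar (xs, \<phi>). \<rho> x \<in> Val M \<and> \<sigma> x = Const (\<rho> x)) \<and>
      (\<forall>x \<in> set xs. \<rho> x \<in> interp_sort M (var_sort M x)) \<and> holds M \<rho> \<phi>)"
  (is "_ \<longleftrightarrow> (\<exists>\<rho>. ?P \<rho>)")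
proof
  \<comment> \<open>By \<open>eval_subst\<close>, applying \<sigma> to the free variables, then
    \<open>vs\<close> to the bound ones, amounts to evaluating under this assignment.\<close>
  let ?val = "\<lambda>\<rho> vs x. eval M \<rho> (subst (value_subst xs vs) (restrict_subst \<sigma> (FVar (xs, \<phi>)) x))"
  {
    assume models: "subst_models M \<sigma> (xs, \<phi>)"
    obtain \<rho> where "is_valuation M \<rho>" using valuation_exists by blast
    then obtain vs where vs: "list_all2 (\<lambda>x v. v \<in> interp_sort M (var_sort M x)) xs vs"
      and h: "holds M (?val \<rho> vs) \<phi>"
      using models by (auto simp: subst_models_def ex_holds_def ex_subst_def holds_def eval_subst)
    \<comment> \<open>Bound variables read their witness. As \<open>xs\<close> may repeat a
      variable, the lookup is the same \<open>map_of\<close> that \<open>value_subst\<close>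
      uses.\<close>
    let ?\<rho> = "\<lambda>x. if x \<in> set xs then the (map_of (zip xs vs) x) else ?val \<rho> vs x"
    have len: "length xs = length vs" using vs by (rule list_all2_lengthD)
    have bound: "\<exists>v. map_of (zip xs vs) x = Some v \<and> v \<in> interp_sort M (var_sort M x)"
      if x: "x \<in> set xs" for x
    proof -
      obtain v where v: "map_of (zip xs vs) x = Some v"
        using x len by (metis map_of_zip_is_Some)
      then have "(x, v) \<in> set (zip xs vs)" by (rule map_of_SomeD)
      then have "v \<in> interp_sort M (var_sort M x)"
        using vs by (auto simp: list_all2_iff)
      with v show ?thesis by blast
    qed
    have free: "\<exists>v \<in> Val M. \<sigma> x = Const v" if "x \<in> FVar (xs, \<phi>)" for x
      using that models by (auto simp: subst_models_def)
    have "?P ?\<rho>"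
    proof (intro conjI ballI)
      fix x assume x: "x \<in> FVar (xs, \<phi>)"
      with free obtain v where v: "v \<in> Val M" "\<sigma> x = Const v" by blast
      moreover have "x \<notin> set xs" using x by (auto simp: FVar_def)
      ultimately show "?\<rho> x \<in> Val M" and "\<sigma> x = Const (?\<rho> x)"
        using x by (simp_all add: restrict_subst_def interp_fun_value)
    next
      fix x assume "x \<in> set xs"
      then show "?\<rho> x \<in> interp_sort M (var_sort M x)" using bound by fastforce
    next
      have "?\<rho> x = ?val \<rho> vs x" if "x \<in> vars_term \<phi>" for x
      proof (cases "x \<in> set xs")
        case True
        with bound obtain v where v: "map_of (zip xs vs) x = Some v"
          "v \<in> interp_sort M (var_sort M x)" by blast
        have "x \<notin> FVar (xs, \<phi>)" using True by (simp add: FVar_def)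
        moreover have "interp_fun M v [] = v"
          using values_are_constants[OF theory_sorts[OF True] v(2)] by simp
        ultimately show ?thesis
          using True v by (simp add: restrict_subst_def value_subst_def)
      qed simp
      then show "holds M ?\<rho> \<phi>"
        using h eval_cong[of \<phi> ?\<rho> "?val \<rho> vs" M] by (simp add: holds_def)
    qed
    then show "\<exists>\<rho>. ?P \<rho>" by (rule exI[of ?P ?\<rho>])
  next
    assume "\<exists>\<rho>. ?P \<rho>"
    then obtain \<rho> where \<rho>: "?P \<rho>" by blast
    \<comment> \<open>Every variable of \<phi> is free or bound, hence replaced by a value; so the
      result is independent of \<rho>' and one list of witnesses serves all valuations.\<close>
    have "?val \<rho>' (map \<rho> xs) x = \<rho> x" if "x \<in> vars_term \<phi>" for x \<rho>'
    proof (cases "x \<in> set xs")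
      case True
      have "x \<notin> FVar (xs, \<phi>)" using True by (simp add: FVar_def)
      moreover have "map_of (zip xs (map \<rho> xs)) x = Some (\<rho> x)"
        using True by (simp add: map_of_zip_map)
      ultimately show ?thesis
        using values_are_constants[OF theory_sorts[OF True], of "\<rho> x"] \<rho> True
        by (simp add: restrict_subst_def value_subst_def)
    next
      case False
      then have "x \<in> FVar (xs, \<phi>)" using that by (simp add: FVar_def)
      then show ?thesis using \<rho> by (simp add: restrict_subst_def interp_fun_value)
    qed
    then have "holds M (?val \<rho>' (map \<rho> xs)) \<phi>" for \<rho>'
      using \<rho> eval_cong[of \<phi> "?val \<rho>' (map \<rho> xs)" \<rho> M] by (simp add: holds_def)
    then have "ex_holds M \<rho>' (ex_subst \<sigma> (xs, \<phi>))" for \<rho>'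
      using \<rho>
      by (auto simp: ex_holds_def ex_subst_def holds_def eval_subst list_all2_map2 list_all2_same
          intro!: exI[of _ "map \<rho> xs"])
    then show "subst_models M \<sigma> (xs, \<phi>)"
      using \<rho> by (auto simp: subst_models_def)
  }
qed

text \<open>Theory symbols take arguments of theory sorts only, so theory sorts propagate from the
  root down to the variables.\<close>

lemma vars_term_theory_sort:
  assumes "has_sort M t \<tau>" and "\<tau> \<in> theory_sorts M" and "funs_term t \<subseteq> theory_syms M"
    and "x \<in> vars_term t"
  shows "var_sort M x \<in> theory_sorts M"
  using assms
proof (induction t arbitrary: \<tau>)
  case (Var y)
  then show ?case by (auto elim: has_sort.cases)
next
  case (Fun f ts)
  obtain \<tau>s where \<tau>s: "fun_sort M f = (\<tau>s, \<tau>)" "list_all2 (has_sort M) ts \<tau>s"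
    using Fun.prems(1) by (auto elim: has_sort.cases)
  obtain i where i: "i < length ts" "x \<in> vars_term (ts ! i)"
    using Fun.prems(4) by (auto simp: in_set_conv_nth)
  have "set \<tau>s \<subseteq> theory_sorts M"
    using theory_sym_sorts[OF _ \<tau>s(1)] Fun.prems(3) by simp
  then have "\<tau>s ! i \<in> theory_sorts M" "has_sort M (ts ! i) (\<tau>s ! i)"
    using i(1) \<tau>s(2) by (auto simp: list_all2_conv_all_nth)
  moreover have "funs_term (ts ! i) \<subseteq> theory_syms M"
    using Fun.prems(3) nth_mem[OF i(1)] by auto
  ultimately show ?case using Fun.IH[of "ts ! i"] i by simp
qed

end


section \<open>Both directions of the equivalence\<close>

text \<open>Fixes one choice of positions, fresh variables and order of bound variables, shared by
  both directions.\<close>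

locale pg_step = constrained_setting M
  for M :: "('s, 'f, 'v) sig_model" +
  fixes X :: "'v set" and s :: "('f, 'v) trm" and xs :: "'v list" and \<phi> :: "('f, 'v) trm"
    and ps :: "pos list" and ws ys :: "'v list"
  assumes ec: "ec_term M (X, s, (xs, \<phi>))"
    and ps: "distinct ps" "set ps = poss_of (X <+> Val M) s"
    and ws: "distinct ws" "set ws \<inter> (X \<union> vars_term s \<union> set xs \<union> vars_term \<phi>) = {}"
      "list_all2 (\<lambda>p w. has_sort M (subt_at s p) (var_sort M w)) ps ws"
    and ys: "set ys = set xs \<union> X"
begin

abbreviation "t \<equiv> replace_parallel s ps (map Var ws)"

abbreviation "\<psi> \<equiv> And M \<phi> (Big_And M (map2 (\<lambda>p w. Eq_Var M (subt_at s p) w) ps ws))"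

lemma len: "length ps = length ws"
  using ws(3) by (rule list_all2_lengthD)

lemma logical: "logical_constraint M \<phi>"
  using ec by (auto simp: ec_term_def ex_constraint_def)

lemma vars_\<phi>: "vars_term \<phi> \<subseteq> set xs \<union> X"
  using ec by (auto simp: ec_term_def FVar_def)

lemma xs_disjoint_X: "set xs \<inter> X = {}"
  using ec by (auto simp: ec_term_def)

lemma theory_xs: "x \<in> set xs \<Longrightarrow> var_sort M x \<in> theory_sorts M"
  using ec bool_sort vars_term_theory_sort[of \<phi> "bool_sort M" x]
  by (auto simp: ec_term_def ex_constraint_def logical_constraint_def)

text \<open>Only the value case yields a theory sort: a variable of \<open>X\<close> may have a term
  sort, which must be excluded later through the substitution.\<close>

lemma zip_pos_cases:
  assumes "(p, w) \<in> set (zip ps ws)"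
  obtains (var) x where "x \<in> X" "subt_at s p = Var x" "var_sort M x = var_sort M w"
  | (val) v where "v \<in> Val M" "subt_at s p = Const v" "var_sort M w \<in> theory_sorts M"
      "v \<in> interp_sort M (var_sort M w)"
proof -
  have sort: "has_sort M (subt_at s p) (var_sort M w)"
    using ws(3) assms by (auto simp: list_all2_iff)
  have root: "root_sym (subt_at s p) \<in> X <+> Val M"
    using assms ps(2) by (auto simp: poss_of_def dest: set_zip_leftD)
  show thesis
  proof (cases "subt_at s p")
    case (Var x)
    with sort root show thesis by (intro var[of x]) (auto elim: has_sort.cases)
  next
    case (Fun v us)
    with root have v: "v \<in> Val M" by auto
    moreover from this have "us = []" using value_no_args sort Fun by metis
    ultimately show thesis
      using val[of v] value_sortD[OF v, of "var_sort M w"] sort Fun by auto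
  qed
qed

lemma zip_of_pos: "p \<in> set ps \<Longrightarrow> \<exists>w. (p, w) \<in> set (zip ps ws)"
  using len by (metis in_set_impl_in_set_zip1)

lemma zip_of_fresh: "w \<in> set ws \<Longrightarrow> \<exists>p. (p, w) \<in> set (zip ps ws)"
  using len by (metis in_set_impl_in_set_zip2)

lemma zip_of_X: "x \<in> X \<Longrightarrow> \<exists>p w. (p, w) \<in> set (zip ps ws) \<and> subt_at s p = Var x"
proof -
  assume x: "x \<in> X"
  then have "x \<in> vars_term s" using ec by (auto simp: ec_term_def)
  then obtain p where "p \<in> poss s" "subt_at s p = Var x"
    by (auto simp: vars_term_iff_subt_at)
  with x show ?thesis using ps(2) zip_of_pos[of p] by (auto simp: poss_of_def)
qed

lemma leaf: "p \<in> set ps \<Longrightarrow> p \<in> poss s \<and> poss (subt_at s p) = {[]}"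
proof -
  assume p: "p \<in> set ps"
  then obtain w where "(p, w) \<in> set (zip ps ws)" using zip_of_pos by blast
  then have "poss (subt_at s p) = {[]}" by (cases rule: zip_pos_cases) auto
  with p show ?thesis using ps(2) by (auto simp: poss_of_def)
qed

text \<open>Every occurrence of a variable of \<open>X\<close> in \<open>s\<close> is at a listed
  position and gets replaced, and the fresh variables avoid \<open>X\<close>.\<close>

lemma X_notin_vars_t: "x \<in> X \<Longrightarrow> x \<notin> vars_term t"
proof
  assume x: "x \<in> X" and "x \<in> vars_term t"
  then obtain q where "q \<in> poss t" "subt_at t q = Var x"
    by (auto simp: vars_term_iff_subt_at)
  then have "x \<in> set ws \<or> (q \<in> poss s \<and> q \<notin> set ps \<and> subt_at s q = Var x)"
    using len ps(1) leaf by (intro subt_at_replace_parallel_VarD) auto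
  then show False using x ws(2) ps(2) by (auto simp: poss_of_def)
qed

text \<open>The variables of \<phi> and of the left-hand sides lie in \<open>xs\<close> or
  \<open>X\<close> and are bound by \<open>ys\<close>; each fresh variable occurs in its own
  equation.\<close>

lemma FVar_\<psi>: "FVar (ys, \<psi>) = set ws"
proof -
  have Big: "vars_term (Big_And M \<theta>s) = (\<Union>\<theta> \<in> set \<theta>s. vars_term \<theta>)"
    for \<theta>s :: "('f, 'v) trm list"
    by (induction \<theta>s) (auto simp: Big_And_def And_def)
  have vars: "vars_term \<psi> = vars_term \<phi> \<union> (\<Union>(p, w) \<in> set (zip ps ws). insert w (vars_term (subt_at s p)))"
    by (auto simp: And_def Big Eq_Var_def split: prod.splits)
  have "w \<in> set ws \<and> vars_term (subt_at s p) \<subseteq> X" if "(p, w) \<in> set (zip ps ws)" for p w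
    using that set_zip_rightD[OF that] by (cases rule: zip_pos_cases) auto
  then have "vars_term \<psi> \<subseteq> set ws \<union> set ys"
    unfolding vars using vars_\<phi> ys by auto
  moreover have "set ws \<subseteq> vars_term \<psi>"
    unfolding vars using zip_of_fresh by fast
  moreover have "set ws \<inter> set ys = {}" using ws(2) ys by auto
  ultimately show ?thesis unfolding FVar_def by auto
qed

lemma eval_subt_at:
  assumes "(p, w) \<in> set (zip ps ws)"
    and "\<And>x. x \<in> X \<Longrightarrow> \<rho> x \<in> interp_sort M (var_sort M x)"
  shows "eval M \<rho> (subt_at s p) \<in> interp_sort M (var_sort M w)"
  using assms(1)
proof (cases rule: zip_pos_cases)
  case (var x)
  then show ?thesis using assms(2)[of x] by simp
qed (simp add: interp_fun_value)

lemma holds_\<psi>_iff: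
  assumes "\<And>x. x \<in> set ys \<Longrightarrow> \<rho> x \<in> interp_sort M (var_sort M x)"
    and "\<And>w. w \<in> set ws \<Longrightarrow>
      var_sort M w \<in> theory_sorts M \<and> \<rho> w \<in> interp_sort M (var_sort M w)"
  shows "holds M \<rho> \<psi> \<longleftrightarrow>
    holds M \<rho> \<phi> \<and> (\<forall>(p, w) \<in> set (zip ps ws). eval M \<rho> (subt_at s p) = \<rho> w)"
proof (rule holds_And_Big_And_Eq_Var)
  show "eval M \<rho> \<phi> = bool_val M (holds M \<rho> \<phi>)"
    using logical assms(1) vars_\<phi> ys by (intro logical_constraint_bool_val) auto
next
  fix p w assume pw: "(p, w) \<in> set (zip ps ws)"
  then have "eval M \<rho> (subt_at s p) \<in> interp_sort M (var_sort M w)"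
    using assms(1) ys by (intro eval_subt_at) auto
  then show "var_sort M w \<in> theory_sorts M \<and>
      eval M \<rho> (subt_at s p) \<in> interp_sort M (var_sort M w) \<and> \<rho> w \<in> interp_sort M (var_sort M w)"
    using assms(2) set_zip_rightD[OF pw] by blast
qed

section \<open>From an instance of the original term to one of its transform\<close>

lemma subsumed_PG: "subsumed M (X, s, (xs, \<phi>)) (set ws, t, (ys, \<psi>))"
proof -
  have "\<exists>\<gamma>. is_subst M \<gamma> \<and> valued M (set ws) \<gamma> \<and> subst_models M \<gamma> (ys, \<psi>) \<and>
      subst \<sigma> s = subst \<gamma> t"
    if \<sigma>: "is_subst M \<sigma>" and X: "valued M X \<sigma>" and models: "subst_models M \<sigma> (xs, \<phi>)" for \<sigma>
  proof -
    obtain \<rho> where free: "\<And>x. x \<in> FVar (xs, \<phi>) \<Longrightarrow> \<sigma> x = Const (\<rho> x)"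
      and bound: "\<And>x. x \<in> set xs \<Longrightarrow> \<rho> x \<in> interp_sort M (var_sort M x)"
      and h: "holds M \<rho> \<phi>"
      using models subst_models_iff[of xs \<sigma> \<phi>, OF theory_xs] by auto
    \<comment> \<open>Inverts the pairing of positions with fresh variables; distinctness of
      \<open>ws\<close> makes the choice unique.\<close>
    define pos where "pos w = (SOME p. (p, w) \<in> set (zip ps ws))" for w
    have pos: "pos w = p" if "(p, w) \<in> set (zip ps ws)" for p w
    proof -
      have "(pos w, w) \<in> set (zip ps ws)" unfolding pos_def using that by (rule someI)
      with that show ?thesis using ws(1) len by (auto simp: in_set_zip nth_eq_iff_index_eq)
    qed
    define \<gamma> where "\<gamma> w = (if w \<in> set ws then subst \<sigma> (subt_at s (pos w)) else \<sigma> w)" for w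
    \<comment> \<open>The old witnesses stay on \<open>xs\<close>; on \<open>X\<close> and
      \<open>ws\<close> the value is read off the constant given by \<gamma>. The remaining
      variables do not occur in \<psi>, so their arbitrary value is harmless.\<close>
    define \<rho>' where "\<rho>' x = (if x \<in> set xs then \<rho> x else SOME v. \<gamma> x = Const v)" for x
    have \<rho>': "\<rho>' x = v" if "x \<notin> set xs" "\<gamma> x = Const v" for x v
      using that by (simp add: \<rho>'_def)
    have \<sigma>_X: "\<exists>v. \<sigma> x = Const v \<and> v \<in> Val M \<and> var_sort M x \<in> theory_sorts M \<and>
        v \<in> interp_sort M (var_sort M x)" if x: "x \<in> X" for x
    proof -
      obtain v where "v \<in> Val M" "\<sigma> x = Const v" using X x by (auto simp: valued_def)
      moreover have "has_sort M (\<sigma> x) (var_sort M x)" using \<sigma> by (simp add: is_subst_def)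
      ultimately show ?thesis using value_sortD[of v "var_sort M x"] by auto
    qed
    have \<gamma>_X: "\<gamma> x = \<sigma> x" if "x \<in> X" for x
      using that ws(2) by (auto simp: \<gamma>_def)
    have \<rho>'_X: "\<sigma> x = Const (\<rho>' x)" "\<rho>' x \<in> interp_sort M (var_sort M x)" if "x \<in> X" for x
      using \<sigma>_X[OF that] \<gamma>_X[OF that] \<rho>'[of x] that xs_disjoint_X by auto
    have zip_fresh: "\<gamma> w = subst \<sigma> (subt_at s p) \<and> \<gamma> w = Const (\<rho>' w) \<and> \<rho>' w \<in> Val M \<and>
        var_sort M w \<in> theory_sorts M \<and> \<rho>' w \<in> interp_sort M (var_sort M w) \<and>
        eval M \<rho>' (subt_at s p) = \<rho>' w" if pw: "(p, w) \<in> set (zip ps ws)" for p w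
    proof -
      have w: "w \<in> set ws" using pw by (rule set_zip_rightD)
      then have w_xs: "w \<notin> set xs" using ws(2) by auto
      have \<gamma>w: "\<gamma> w = subst \<sigma> (subt_at s p)" using w pos[OF pw] by (simp add: \<gamma>_def)
      from pw show ?thesis
      proof (cases rule: zip_pos_cases)
        case (var x)
        then show ?thesis using \<sigma>_X[of x] \<rho>'_X[of x] \<rho>'[OF w_xs] \<gamma>w by auto
      next
        case (val v)
        then show ?thesis using \<rho>'[OF w_xs, of v] \<gamma>w by (simp add: interp_fun_value)
      qed
    qed
    have fresh: "\<gamma> w = Const (\<rho>' w) \<and> \<rho>' w \<in> Val M \<and>
        var_sort M w \<in> theory_sorts M \<and> \<rho>' w \<in> interp_sort M (var_sort M w)"
      if "w \<in> set ws" for w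
      using zip_of_fresh[OF that] zip_fresh by blast
    have \<rho>'_ys: "\<rho>' y \<in> interp_sort M (var_sort M y)" if "y \<in> set ys" for y
    proof (cases "y \<in> X")
      case True
      then show ?thesis by (rule \<rho>'_X(2))
    next
      case False
      with that ys have "y \<in> set xs" by auto
      then show ?thesis using bound by (simp add: \<rho>'_def)
    qed
    \<comment> \<open>Nothing is known of \<rho> on variables of \<open>X\<close> outside \<phi>, so
      agreement is claimed only on the variables of \<phi>.\<close>
    have "\<rho> x = \<rho>' x" if "x \<in> vars_term \<phi>" for x
    proof (cases "x \<in> set xs")
      case False
      then have "\<sigma> x = Const (\<rho> x)" and "x \<in> X"
        using free that vars_\<phi> by (auto simp: FVar_def)
      then show ?thesis using \<rho>'_X(1)[of x] by simp
    qed (simp add: \<rho>'_def)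
    then have "holds M \<rho>' \<phi>" using h eval_cong[of \<phi> \<rho> \<rho>' M] by (simp add: holds_def)
    then have "holds M \<rho>' \<psi>"
      using holds_\<psi>_iff[of \<rho>'] \<rho>'_ys fresh zip_fresh by blast
    \<comment> \<open>For \<open>y\<close> in \<open>X\<close> this comes from \<sigma> being
      \<open>X\<close>-valued.\<close>
    moreover have "var_sort M y \<in> theory_sorts M" if "y \<in> set ys" for y
      using that ys theory_xs \<sigma>_X by blast
    ultimately have "subst_models M \<gamma> (ys, \<psi>)"
      using \<rho>'_ys fresh FVar_\<psi> subst_models_iff[of ys \<gamma> \<psi>] by blast
    moreover have "is_subst M \<gamma>"
      unfolding is_subst_def
    proof
      fix x
      show "has_sort M (\<gamma> x) (var_sort M x)"
      proof (cases "x \<in> set ws")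
        case True
        then show ?thesis using fresh[OF True] has_sort_Const_value by simp
      next
        case False
        then show ?thesis using \<sigma> by (simp add: \<gamma>_def is_subst_def)
      qed
    qed
    moreover have "valued M (set ws) \<gamma>"
      using fresh by (auto simp: valued_def)
    moreover have "subst \<gamma> t = subst \<gamma> s"
    proof (rule subst_replace_parallel[OF len ps(1) leaf])
      fix p w assume pw: "(p, w) \<in> set (zip ps ws)"
      have "subst \<gamma> (subt_at s p) = subst \<sigma> (subt_at s p)"
        using pw by (cases rule: zip_pos_cases) (auto simp: \<gamma>_X)
      then show "\<gamma> w = subst \<gamma> (subt_at s p)" using zip_fresh[OF pw] by simp
    qed
    moreover have "subst \<gamma> s = subst \<sigma> s"
      using ws(2) by (intro subst_cong) (auto simp: \<gamma>_def)
    ultimately show ?thesis by metis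
  qed
  then show ?thesis by (auto simp: subsumed_def)
qed

section \<open>From an instance of the transform back to one of the original term\<close>

lemma PG_subsumed: "subsumed M (set ws, t, (ys, \<psi>)) (X, s, (xs, \<phi>))"
proof -
  have "\<exists>\<sigma>. is_subst M \<sigma> \<and> valued M X \<sigma> \<and> subst_models M \<sigma> (xs, \<phi>) \<and>
      subst \<gamma> t = subst \<sigma> s"
    if \<gamma>: "is_subst M \<gamma>" and Y: "valued M (set ws) \<gamma>" and models: "subst_models M \<gamma> (ys, \<psi>)" for \<gamma>
  proof -
    have \<gamma>_ws: "var_sort M w \<in> theory_sorts M \<and> v \<in> interp_sort M (var_sort M w)"
      if w: "w \<in> set ws" and v: "\<gamma> w = Const v" for w v
    proof -
      have "v \<in> Val M" using Y w v by (auto simp: valued_def)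
      moreover have "has_sort M (Const v) (var_sort M w)"
        using \<gamma> v by (metis is_subst_def)
      ultimately show ?thesis using value_sortD by blast
    qed
    \<comment> \<open>The variable \<open>x\<close> has the sort of some fresh \<open>w\<close>, and
      \<gamma> sends \<open>w\<close> to a value. This makes \<open>subst_models_iff\<close>
      applicable to \<open>ys\<close>, which contains \<open>X\<close>.\<close>
    have theory_X: "var_sort M x \<in> theory_sorts M" if x: "x \<in> X" for x
    proof -
      obtain p w where pw: "(p, w) \<in> set (zip ps ws)" "subt_at s p = Var x"
        using zip_of_X[OF x] by blast
      from pw(1) have "var_sort M x = var_sort M w"
        by (cases rule: zip_pos_cases) (use pw(2) in auto)
      moreover have w: "w \<in> set ws" using pw(1) by (rule set_zip_rightD)
      moreover obtain v where "\<gamma> w = Const v" using Y w by (auto simp: valued_def)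
      ultimately show ?thesis using \<gamma>_ws by simp
    qed
    have "\<And>y. y \<in> set ys \<Longrightarrow> var_sort M y \<in> theory_sorts M"
      using ys theory_xs theory_X by blast
    then obtain \<rho> where free: "\<And>w. w \<in> set ws \<Longrightarrow> \<rho> w \<in> Val M \<and> \<gamma> w = Const (\<rho> w)"
      and bound: "\<And>y. y \<in> set ys \<Longrightarrow> \<rho> y \<in> interp_sort M (var_sort M y)"
      and h: "holds M \<rho> \<psi>"
      using models FVar_\<psi> subst_models_iff[of ys \<gamma> \<psi>] by blast
    have h\<phi>: "holds M \<rho> \<phi>"
      and eqs: "\<And>p w. (p, w) \<in> set (zip ps ws) \<Longrightarrow> eval M \<rho> (subt_at s p) = \<rho> w"
      using holds_\<psi>_iff[of \<rho>] bound free \<gamma>_ws h by blast+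
    \<comment> \<open>The existential witnesses for \<open>X\<close> become the substitution on
      \<open>X\<close>. Elsewhere \<gamma> is kept, in particular on \<open>ws\<close>.\<close>
    define \<sigma> where "\<sigma> x = (if x \<in> X then Const (\<rho> x) else \<gamma> x)" for x
    have \<rho>_X: "\<rho> x \<in> Val M \<and> \<sigma> x = Const (\<rho> x)" if "x \<in> X" for x
      using that bound[of x] ys theory_X[of x] by (auto simp: \<sigma>_def Val_def)
    have "is_subst M \<sigma>"
      using \<gamma> bound ys theory_X has_sort_Const_value by (auto simp: is_subst_def \<sigma>_def)
    moreover have "valued M X \<sigma>"
      using \<rho>_X by (auto simp: valued_def)
    moreover have "FVar (xs, \<phi>) \<subseteq> X" using vars_\<phi> by (auto simp: FVar_def)
    then have "subst_models M \<sigma> (xs, \<phi>)"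
      using subst_models_iff[of xs \<sigma> \<phi>, OF theory_xs] \<rho>_X bound ys h\<phi> by blast
    moreover have "subst \<sigma> t = subst \<sigma> s"
    proof (rule subst_replace_parallel[OF len ps(1) leaf])
      fix p w assume pw: "(p, w) \<in> set (zip ps ws)"
      then have w: "w \<in> set ws" by (rule set_zip_rightD)
      then have "\<sigma> w = Const (\<rho> w)" using free ws(2) by (auto simp: \<sigma>_def)
      \<comment> \<open>The replaced leaf is a value or a variable of \<open>X\<close>, so its
        instance is the constant of its evaluation, which the equation in \<psi> identifies with the
        value of \<open>w\<close>.\<close>
      moreover from pw have "subst \<sigma> (subt_at s p) = Const (eval M \<rho> (subt_at s p))"
        by (cases rule: zip_pos_cases) (auto simp: \<rho>_X interp_fun_value)
      ultimately show "\<sigma> w = subst \<sigma> (subt_at s p)" using eqs[OF pw] by simp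
    qed
    moreover have "subst \<sigma> t = subst \<gamma> t"
      using X_notin_vars_t by (intro subst_cong) (auto simp: \<sigma>_def)
    ultimately show ?thesis by metis
  qed
  then show ?thesis by (auto simp: subsumed_def)
qed

end

text \<open>\<open>D\<close> ranges over all results of the transformation, so the equivalence holds
  for every choice made in it; \<open>PG_exists\<close> provides at least one.\<close>

theorem theorem2:
  fixes M :: "('s, 'f, 'v) sig_model"
    and X :: "'v set" and s :: "('f, 'v) trm" and xs :: "'v list" and \<phi> :: "('f, 'v) trm"
    and D :: "('f, 'v) ec_term"
  assumes "constrained_setting M"
    and "ec_term M (X, s, (xs, \<phi>))"
    and "PG M (X, s, (xs, \<phi>)) D"
  shows "ec_equiv M (X, s, (xs, \<phi>)) D"
proof -
  obtain Y t ys \<psi> where D: "D = (Y, t, (ys, \<psi>))" by (metis prod.exhaust)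
  from assms(3) obtain ps ws where
    "distinct ps" "set ps = poss_of (X <+> Val M) s"
    "distinct ws" "set ws \<inter> (X \<union> vars_term s \<union> set xs \<union> vars_term \<phi>) = {}"
    "list_all2 (\<lambda>p w. has_sort M (subt_at s p) (var_sort M w)) ps ws"
    "set ys = set xs \<union> X"
    and eqs: "Y = set ws" "t = replace_parallel s ps (map Var ws)"
    "\<psi> = And M \<phi> (Big_And M (map2 (\<lambda>p w. Eq_Var M (subt_at s p) w) ps ws))"
    unfolding D PG_def by blast
  with assms(1,2) have "pg_step M X s xs \<phi> ps ws ys"
    by (intro pg_step.intro pg_step_axioms.intro)
  then show ?thesis
    unfolding D eqs ec_equiv_def using pg_step.subsumed_PG pg_step.PG_subsumed by blast
qed

end
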